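(* Let $G$ be a finitely generated group, $\Bbbk$ a field with a possibly trivial valuation $\upsilon\colon\Bbbk^\times\to\mathbb{R}$, and $\mathbb{K}\supseteq\Bbbk$ an algebraically closed field with a nontrivial valuation extending $\upsilon$, still denoted $\upsilon$. Let $\hat{\mathbb{K}}$ be the topological completion of $\mathbb{K}$ with respect to the absolute value defined by $\upsilon$. Let $\sigma\colon G\to\mathrm{GL}_r(\Bbbk)$ be a representation, let $\rho\colon G\to\mathbb{K}^\times$ be a character, and set $\chi=\upsilon\circ\det\circ(\sigma\otimes\rho)\colon G\to\mathbb{R}$. Assume: (i) there exists $d\in\mathbb{R}$ such that $\upsilon([\sigma(g)]_{ij})\ge d$ for all $g\in G$ and $1\le i,j\le r$; (ii) $\upsilon(\det(\sigma(g)))=0$ for all $g\in G$. Then: (1) $\chi=r(\upsilon\circ\rho)$; (2) $\hat{\mathbb{K}}^r$ is a left $\widehat{\mathbb{Z}G}_{-\chi}$-module via $\sigma\otimes\rho$; that is, for every $\sum n_g g\in\widehat{\mathbb{Z}G}_{-\chi}$ and $v\in\hat{\mathbb{K}}^r$ the series $\sum n_g\,\rho(g)\sigma(g)v$ converges in $\hat{\mathbb{K}}^r$, and this defines a left $\widehat{\mathbb{Z}G}_{-\chi}$-module structure on $\hat{\mathbb{K}}^r$.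
   Context: Valuations are non-archimedean, with $\upsilon(0)=\infty$. The representation $\sigma\otimes\rho\colon G\to\mathrm{GL}_r(\mathbb{K})$ is $g\mapsto\rho(g)\sigma(g)$. The Novikov–Sikorav completion $\widehat{\mathbb{Z}G}_{\psi}$ of $\mathbb{Z}G$ with respect to a homomorphism $\psi\colon G\to\mathbb{R}$ is the ring of all formal sums $\sum_{g\in G} n_g g$, $n_g\in\mathbb{Z}$, such that for each $c\in\mathbb{R}$ the set $\{g\in G\mid n_g\ne0\text{ and }\psi(g)\ge c\}$ is finite, with the usual addition and the multiplication extending that of $\mathbb{Z}G$. In particular, for $\psi=-\chi$, the condition is that $\{g\mid n_g\neq 0,\ \chi(g)\le c\}$ is finite for each $c$. *)

theory Defs
  imports "HOL-Analysis.Analysis" "HOL-Algebra.Algebra" "HOL-Algebra.Algebraic_Closure_Type"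
begin

text \<open>Groups and the (noncommutative) Novikov--Sikorav ring are \<open>HOL-Algebra\<close> structures; the fields
  are types, viewed as \<open>HOL-Algebra\<close> rings through \<open>ring_of_type_algebra\<close> where needed.\<close>

definition finitely_generated_group :: "('g, 'b) monoid_scheme \<Rightarrow> bool" where
  "finitely_generated_group G \<longleftrightarrow>
     group G \<and> (\<exists>S. finite S \<and> S \<subseteq> carrier G \<and> generate G S = carrier G)"


section \<open>Valued fields\<close>

text \<open>Valuations are written additively, with values in the reals on nonzero elements.\<close>

definition is_valuation :: "('a::field \<Rightarrow> ereal) \<Rightarrow> bool" where
  "is_valuation v \<longleftrightarrow>
     v 0 = \<infinity> \<and>
     (\<forall>x. x \<noteq> 0 \<longrightarrow> \<bar>v x\<bar> \<noteq> \<infinity>) \<and>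
     (\<forall>x y. v (x * y) = v x + v y) \<and>
     (\<forall>x y. min (v x) (v y) \<le> v (x + y))"

definition nontrivial_valuation :: "('a::field \<Rightarrow> ereal) \<Rightarrow> bool" where
  "nontrivial_valuation v \<longleftrightarrow> (\<exists>x. x \<noteq> 0 \<and> v x \<noteq> 0)"

definition val_abs :: "('a::field \<Rightarrow> ereal) \<Rightarrow> 'a \<Rightarrow> real" where
  "val_abs v x = (if x = 0 then 0 else exp (- real_of_ereal (v x)))"

text \<open>\<open>i\<close> exhibits the field \<open>'b\<close> with valuation \<open>w\<close> as a valued extension of \<open>'a\<close> with valuation
  \<open>v\<close>; ring homomorphisms (preserving \<open>1\<close>) between fields are injective.\<close>

definition valued_extension ::
    "('a::field \<Rightarrow> ereal) \<Rightarrow> ('b::field \<Rightarrow> ereal) \<Rightarrow> ('a \<Rightarrow> 'b) \<Rightarrow> bool" where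
  "valued_extension v w i \<longleftrightarrow>
     is_valuation v \<and> is_valuation w \<and>
     i \<in> ring_hom ring_of_type_algebra ring_of_type_algebra \<and>
     (\<forall>x. w (i x) = v x)"

text \<open>A completion: a valued extension which, for the metric given by its absolute value, is a
  complete space (this is the class constraint) in which the original field is dense. It is unique
  up to a unique isometric isomorphism over \<open>'a\<close>.\<close>

definition is_completion ::
    "('a::field \<Rightarrow> ereal) \<Rightarrow> ('h::{field, complete_space} \<Rightarrow> ereal) \<Rightarrow> ('a \<Rightarrow> 'h) \<Rightarrow> bool" where
  "is_completion v w j \<longleftrightarrow>
     valued_extension v w j \<and>
     (\<forall>x y. dist x y = val_abs w (x - y)) \<and>
     closure (range j) = UNIV"


section \<open>Representations\<close>

definition GL :: "('a::field ^ 'r ^ 'r) monoid" where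
  "GL = \<lparr>carrier = {A. invertible A}, monoid.mult = (**), one = mat 1\<rparr>"

definition mult_group :: "'a::field monoid" where
  "mult_group = units_of ring_of_type_algebra"

definition twist ::
    "('k \<Rightarrow> 'a::field) \<Rightarrow> ('g \<Rightarrow> 'k::field ^ 'r ^ 'r) \<Rightarrow> ('g \<Rightarrow> 'a) \<Rightarrow> 'g \<Rightarrow> 'a ^ 'r ^ 'r" where
  "twist i \<sigma> \<rho> g = (\<chi> a b. \<rho> g * i (\<sigma> g $ a $ b))"


text \<open>The value of \<open>det\<close> is finite on invertible matrices, the only ones of interest.\<close>

definition twist_char ::
    "('a::field \<Rightarrow> ereal) \<Rightarrow> ('k \<Rightarrow> 'a) \<Rightarrow> ('g \<Rightarrow> 'k::field ^ 'r ^ 'r) \<Rightarrow> ('g \<Rightarrow> 'a) \<Rightarrow> 'g \<Rightarrow> real" where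
  "twist_char v i \<sigma> \<rho> g = real_of_ereal (v (det (twist i \<sigma> \<rho> g)))"


section \<open>The Novikov--Sikorav completion\<close>

text \<open>A formal sum is its coefficient function, extended by zero outside \<open>carrier G\<close>. In the
  convolution product only the finitely many \<open>h\<close> with both factors nonzero are summed over.\<close>

definition novikov :: "('g, 'b) monoid_scheme \<Rightarrow> ('g \<Rightarrow> real) \<Rightarrow> ('g \<Rightarrow> int) ring" where
  "novikov G \<psi> =
    \<lparr>carrier = {n. (\<forall>g. g \<notin> carrier G \<longrightarrow> n g = 0) \<and>
                   (\<forall>c. finite {g \<in> carrier G. n g \<noteq> 0 \<and> \<psi> g \<ge> c})},
     monoid.mult = (\<lambda>m n g. if g \<in> carrier G
               then \<Sum>h\<in>{h \<in> carrier G. m h \<noteq> 0 \<and> n (inv\<^bsub>G\<^esub> h \<otimes>\<^bsub>G\<^esub> g) \<noteq> 0}.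
                      m h * n (inv\<^bsub>G\<^esub> h \<otimes>\<^bsub>G\<^esub> g)
               else 0),
     monoid.one = (\<lambda>g. if g = \<one>\<^bsub>G\<^esub> then 1 else 0),
     ring.zero = (\<lambda>g. 0),
     ring.add = (\<lambda>m n g. m g + n g)\<rparr>"


section \<open>Left modules\<close>

text \<open>The library's \<open>module\<close> locale requires a commutative ring of scalars; these are the same axioms
  over an arbitrary ring.\<close>

locale left_module = R?: Ring.ring R + M?: abelian_group M
  for R :: "('c, 'd) ring_scheme" (structure) and M :: "('c, 'm, 'e) module_scheme" (structure) +
  assumes smult_closed:
      "\<lbrakk>a \<in> carrier R; x \<in> carrier M\<rbrakk> \<Longrightarrow> a \<odot>\<^bsub>M\<^esub> x \<in> carrier M"
    and smult_l_distr:
      "\<lbrakk>a \<in> carrier R; b \<in> carrier R; x \<in> carrier M\<rbrakk> \<Longrightarrow>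
        (a \<oplus>\<^bsub>R\<^esub> b) \<odot>\<^bsub>M\<^esub> x = a \<odot>\<^bsub>M\<^esub> x \<oplus>\<^bsub>M\<^esub> b \<odot>\<^bsub>M\<^esub> x"
    and smult_r_distr:
      "\<lbrakk>a \<in> carrier R; x \<in> carrier M; y \<in> carrier M\<rbrakk> \<Longrightarrow>
        a \<odot>\<^bsub>M\<^esub> (x \<oplus>\<^bsub>M\<^esub> y) = a \<odot>\<^bsub>M\<^esub> x \<oplus>\<^bsub>M\<^esub> a \<odot>\<^bsub>M\<^esub> y"
    and smult_assoc1:
      "\<lbrakk>a \<in> carrier R; b \<in> carrier R; x \<in> carrier M\<rbrakk> \<Longrightarrow>
        (a \<otimes>\<^bsub>R\<^esub> b) \<odot>\<^bsub>M\<^esub> x = a \<odot>\<^bsub>M\<^esub> (b \<odot>\<^bsub>M\<^esub> x)"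
    and smult_one: "x \<in> carrier M \<Longrightarrow> \<one>\<^bsub>R\<^esub> \<odot>\<^bsub>M\<^esub> x = x"

text \<open>The additive group of \<open>'h ^ 'r\<close> with a given scalar action. The \<open>module\<close> record also carries the
  ring fields \<open>mult\<close> and \<open>one\<close>, which play no role for modules.\<close>

definition vec_module :: "('c \<Rightarrow> 'h::field ^ 'r \<Rightarrow> 'h ^ 'r) \<Rightarrow> ('c, 'h ^ 'r) module" where
  "vec_module act =
    \<lparr>carrier = UNIV, monoid.mult = undefined, one = undefined, ring.zero = 0, add = (+), smult = act\<rparr>"

definition twist_term ::
    "('a \<Rightarrow> 'h) \<Rightarrow> ('k \<Rightarrow> 'a::field) \<Rightarrow> ('g \<Rightarrow> 'k::field ^ 'r ^ 'r) \<Rightarrow> ('g \<Rightarrow> 'a) \<Rightarrow>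
      ('g \<Rightarrow> int) \<Rightarrow> 'h::field ^ 'r \<Rightarrow> 'g \<Rightarrow> 'h ^ 'r" where
  "twist_term j i \<sigma> \<rho> n x g = of_int (n g) *s (map_matrix j (twist i \<sigma> \<rho> g) *v x)"

end

theory Submission
  imports Defs
begin

text \<open>
  The determinant of \<open>\<rho>(g)\<sigma>(g)\<close> is \<open>\<rho>(g)\<^sup>r det \<sigma>(g)\<close>, and \<open>det \<sigma>(g)\<close> has value \<open>0\<close>; this is the
  formula \<open>\<chi> = r (\<upsilon> \<circ> \<rho>)\<close>. In terms of absolute values and \<open>\<psi> = - \<chi>\<close> it says
  \<open>\<bar>\<rho>(g)\<bar> = exp (\<psi>(g) / r)\<close>, so the uniform bound on the entries of \<open>\<sigma>\<close> gives
  \<open>\<bar>\<rho>(g) \<sigma>(g)\<^sub>a\<^sub>b\<bar> \<le> exp (- d) exp (\<psi>(g) / r)\<close>. Integers have absolute value at most \<open>1\<close>, so the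
  term of \<open>g\<close> in the series of \<open>n\<close> at \<open>x\<close> is at least \<open>e\<close> in norm only if \<open>n\<^sub>g \<noteq> 0\<close> and \<open>\<psi>(g)\<close> is above
  a threshold depending on \<open>e\<close> and \<open>x\<close>. The Novikov condition leaves finitely many such \<open>g\<close>.
  Thus the terms tend to zero, which in a complete non-archimedean group is enough for the series
  to converge unconditionally (\<open>vanishing_imp_summable_on\<close>).

  Compatibility of the action with the product is a rearrangement of the double series with terms
  \<open>m\<^sub>h n\<^sub>k M(hk) x\<close>, where \<open>M(g) = \<rho>(g)\<sigma>(g)\<close>. It tends to zero over \<open>G \<times> G\<close>, because the support of a Novikov series is bounded
  above with respect to \<open>\<psi>\<close>, so that only finitely many pairs in the supports have
  \<open>\<psi>(h) + \<psi>(k)\<close> above a given threshold (\<open>finite_support_pairs\<close>). The non-archimedean Fubini theorem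
  (\<open>has_sum_Times_iterated\<close>) computes its sum both by rows, which yields \<open>m (n x)\<close>, and along the
  fibres \<open>hk = g\<close>, which yields \<open>(m n) x\<close>.

  The same finiteness of pairs makes the convolution product well defined; to compare two iterated
  convolutions at a given \<open>g\<close>, both are rewritten as sums over common finite sets large enough to
  contain all nonzero contributions (\<open>novikov_assoc\<close>).
\<close>

section \<open>Unconditional sums in complete non-archimedean groups\<close>

text \<open>The ultrametric size \<open>N\<close> is only required to be equivalent to the metric, since the metric on
  \<open>'h ^ 'r\<close> is the Euclidean combination of the metrics of the coordinates and not the sup metric.\<close>



locale ultrametric_group =
  fixes N :: "'m::{ab_group_add, complete_space} \<Rightarrow> real" and C :: real
  assumes C_pos: "0 < C"
    and N_le_dist: "N (x - y) \<le> dist x y"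
    and dist_le_N: "dist x y \<le> C * N (x - y)"
    and N_add: "N (x + y) \<le> max (N x) (N y)"
    and N_uminus: "N (- x) = N x"
begin

lemma N_nonneg: "0 \<le> N x"
proof -
  have "0 \<le> C * N (x - 0)"
    using zero_le_dist dist_le_N by (rule order_trans)
  with C_pos show ?thesis
    by (simp add: zero_le_mult_iff)
qed

lemma N_zero [simp]: "N 0 = 0"
  using N_le_dist[of 0 0] N_nonneg[of 0] by simp

lemma N_add_less: "N x < e \<Longrightarrow> N y < e \<Longrightarrow> N (x + y) < e"
  using N_add[of x y] by simp

lemma N_diff_commute: "N (x - y) = N (y - x)"
  using N_uminus[of "x - y"] by simp

lemma N_diff_less_trans: "N (x - y) < e \<Longrightarrow> N (y - z) < e \<Longrightarrow> N (x - z) < e"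
  using N_add_less[of "x - y" e "y - z"] by simp

lemma N_sum_less:
  assumes "0 < e" "\<And>g. g \<in> S \<Longrightarrow> N (f g) < e"
  shows "N (sum f S) < e"
  using assms(2)
proof (induction S rule: infinite_finite_induct)
  case (insert g S)
  then show ?case
    using N_add[of "f g" "sum f S"] by fastforce
qed (use \<open>0 < e\<close> in auto)

lemma has_sum_iff_N:
  "(f has_sum l) A \<longleftrightarrow>
    (\<forall>e>0. \<exists>S. finite S \<and> S \<subseteq> A \<and>
      (\<forall>Y. finite Y \<and> S \<subseteq> Y \<and> Y \<subseteq> A \<longrightarrow> N (sum f Y - l) < e))"
    (is "?L \<longleftrightarrow> ?R")
proof
  assume ?L
  then have ev: "\<forall>\<^sub>F S in finite_subsets_at_top A. dist (sum f S) l < e" if "e > 0" for e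
    using that unfolding has_sum_def tendsto_iff by blast
  show ?R
  proof (intro allI impI)
    fix e :: real
    assume "0 < e"
    from ev[OF this] obtain S where
      "finite S" "S \<subseteq> A" "\<And>Y. finite Y \<Longrightarrow> S \<subseteq> Y \<Longrightarrow> Y \<subseteq> A \<Longrightarrow> dist (sum f Y) l < e"
      unfolding eventually_finite_subsets_at_top by auto
    then show "\<exists>S. finite S \<and> S \<subseteq> A \<and>
        (\<forall>Y. finite Y \<and> S \<subseteq> Y \<and> Y \<subseteq> A \<longrightarrow> N (sum f Y - l) < e)"
      using N_le_dist le_less_trans by (metis (no_types, lifting))
  qed
next
  assume R: ?R
  show ?L
    unfolding has_sum_def tendsto_iff eventually_finite_subsets_at_top
  proof (intro allI impI)
    fix e :: real
    assume "0 < e"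
    then have "0 < e / C"
      using C_pos by simp
    with R obtain S where S: "finite S" "S \<subseteq> A"
      "\<And>Y. finite Y \<Longrightarrow> S \<subseteq> Y \<Longrightarrow> Y \<subseteq> A \<Longrightarrow> N (sum f Y - l) < e / C"
      by meson
    have "dist (sum f Y) l < e" if "finite Y" "S \<subseteq> Y" "Y \<subseteq> A" for Y
      using dist_le_N[of "sum f Y" l] S(3)[OF that] C_pos
      by (simp add: field_simps)
    with S show "\<exists>S. finite S \<and> S \<subseteq> A \<and>
        (\<forall>Y. finite Y \<and> S \<subseteq> Y \<and> Y \<subseteq> A \<longrightarrow> dist (sum f Y) l < e)"
      by (intro exI[of _ S]) simp
  qed
qed

lemma has_sumE_N:
  assumes "(f has_sum l) A" "0 < e"
  obtains S where "finite S" "S \<subseteq> A"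
    "\<And>Y. finite Y \<Longrightarrow> S \<subseteq> Y \<Longrightarrow> Y \<subseteq> A \<Longrightarrow> N (sum f Y - l) < e"
  using assms(1)[unfolded has_sum_iff_N, rule_format, OF assms(2)] that by auto

definition vanishing :: "('i \<Rightarrow> 'm) \<Rightarrow> 'i set \<Rightarrow> bool" where
  "vanishing f A \<longleftrightarrow> (\<forall>e>0. finite {g \<in> A. e \<le> N (f g)})"

lemma sum_diff_less:
  assumes "0 < e" "finite Y" "S \<subseteq> Y" "\<And>g. g \<in> Y - S \<Longrightarrow> N (f g) < e"
  shows "N (sum f Y - sum f S) < e"
proof -
  have "N (sum f (Y - S)) < e"
    using assms(1,4) by (rule N_sum_less)
  then show ?thesis
    using assms(2,3) by (simp add: sum_diff finite_subset)
qed

text \<open>The ultrametric tail estimate: discarding infinitely many terms of size less than \<open>e\<close> changes the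
  sum by less than \<open>e\<close>.\<close>

lemma has_sum_diff_less:
  assumes l: "(f has_sum l) A" and "0 < e" and S: "finite S" "S \<subseteq> A"
    and small: "\<And>g. g \<in> A - S \<Longrightarrow> N (f g) < e"
  shows "N (l - sum f S) < e"
proof -
  obtain Z where Z: "finite Z" "Z \<subseteq> A"
    "\<And>Y. finite Y \<Longrightarrow> Z \<subseteq> Y \<Longrightarrow> Y \<subseteq> A \<Longrightarrow> N (sum f Y - l) < e"
    using has_sumE_N[OF l \<open>0 < e\<close>] by metis
  have "N (l - sum f (S \<union> Z)) < e"
    using Z S by (subst N_diff_commute) simp
  moreover have "N (sum f (S \<union> Z) - sum f S) < e"
    by (rule sum_diff_less) (use assms Z in auto)
  ultimately show ?thesis
    by (rule N_diff_less_trans)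
qed

text \<open>By the ultrametric inequality, two finite partial sums that both contain all terms of size at
  least \<open>e\<close> differ by less than \<open>e\<close>. So the partial sums over \<open>{g. 1/(n+1) \<le> N (f g)}\<close> form a Cauchy
  sequence, whose limit is the sum.\<close>

lemma vanishing_imp_summable_on:
  assumes "vanishing f A"
  shows "f summable_on A"
proof -
  define S where "S n = {g \<in> A. inverse (real (Suc n)) \<le> N (f g)}" for n
  have S: "finite (S n)" "S n \<subseteq> A" for n
    using assms unfolding vanishing_def S_def by auto
  have near: "N (sum f Y - sum f (S n)) < e"
    if "finite Y" "S n \<subseteq> Y" "Y \<subseteq> A" "inverse (real (Suc n)) \<le> e" for n Y e
  proof (rule sum_diff_less)
    have "0 < inverse (real (Suc n))"
      by simp
    then show "0 < e"
      using that(4) by (rule less_le_trans)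
  qed (use that in \<open>auto simp: S_def not_le intro: less_le_trans\<close>)
  have S_mono: "S m \<subseteq> S n" if "m \<le> n" for m n
  proof -
    have "inverse (real (Suc n)) \<le> inverse (real (Suc m))"
      using that by (intro le_imp_inverse_le) auto
    then show ?thesis
      unfolding S_def using order_trans by blast
  qed
  have "Cauchy (\<lambda>n. sum f (S n))"
  proof (rule metric_CauchyI)
    fix e :: real
    assume "0 < e"
    then have "0 < e / C"
      using C_pos by simp
    then obtain k where k: "inverse (real (Suc k)) < e / C"
      using reals_Archimedean by blast
    have near_k: "N (sum f (S m) - sum f (S k)) < e / C" if "m \<ge> k" for m
      by (rule near[OF S(1) S_mono[OF that] S(2) less_imp_le[OF k]])
    have "dist (sum f (S m)) (sum f (S n)) < e" if "m \<ge> k" "n \<ge> k" for m n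
    proof -
      have "N (sum f (S m) - sum f (S n)) < e / C"
        using near_k[OF that(1)] near_k[OF that(2)]
        by (subst (asm) (2) N_diff_commute) (rule N_diff_less_trans)
      then have "C * N (sum f (S m) - sum f (S n)) < e"
        using C_pos by (simp add: field_simps)
      with dist_le_N show ?thesis
        by (rule le_less_trans)
    qed
    then show "\<exists>M. \<forall>m\<ge>M. \<forall>n\<ge>M. dist (sum f (S m)) (sum f (S n)) < e"
      by blast
  qed
  then obtain l where l: "(\<lambda>n. sum f (S n)) \<longlonglongrightarrow> l"
    using Cauchy_convergent convergent_def by blast
  have "(f has_sum l) A"
    unfolding has_sum_iff_N
  proof (intro allI impI)
    fix e :: real
    assume "0 < e"
    then obtain k where k: "inverse (real (Suc k)) < e"
      using reals_Archimedean by blast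
    obtain k' where k': "\<And>n. n \<ge> k' \<Longrightarrow> dist (sum f (S n)) l < e"
      using l \<open>0 < e\<close> unfolding lim_sequentially by blast
    define n where "n = max k k'"
    have n: "N (sum f (S n) - l) < e"
      using k'[of n] N_le_dist[of "sum f (S n)" l] by (simp add: n_def)
    have "N (sum f Y - l) < e" if "finite Y" "S n \<subseteq> Y" "Y \<subseteq> A" for Y
    proof -
      have "inverse (real (Suc n)) \<le> inverse (real (Suc k))"
        unfolding n_def by (intro le_imp_inverse_le) auto
      also have "\<dots> \<le> e"
        using k by (rule less_imp_le)
      finally have "N (sum f Y - sum f (S n)) < e"
        by (rule near[OF that])
      then show ?thesis
        using n by (rule N_diff_less_trans)
    qed
    then show "\<exists>S. finite S \<and> S \<subseteq> A \<and>
        (\<forall>Y. finite Y \<and> S \<subseteq> Y \<and> Y \<subseteq> A \<longrightarrow> N (sum f Y - l) < e)"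
      using S by (intro exI[of _ "S n"]) simp
  qed
  then show ?thesis
    unfolding summable_on_def by blast
qed

text \<open>The topology comes from \<open>N\<close>, and the sort of \<open>'m\<close> does not provide continuity of addition; it is the
  ultrametric inequality that makes the sum of two convergent series converge.\<close>

lemma has_sum_add_N:
  fixes f g :: "'i \<Rightarrow> 'm"
  assumes f: "(f has_sum k) A" and g: "(g has_sum l) A"
  shows "((\<lambda>x. f x + g x) has_sum (k + l)) A"
  unfolding has_sum_iff_N
proof (intro allI impI)
  fix e :: real
  assume e: "0 < e"
  obtain S where S: "finite S" "S \<subseteq> A"
    "\<And>Z. finite Z \<Longrightarrow> S \<subseteq> Z \<Longrightarrow> Z \<subseteq> A \<Longrightarrow> N (sum f Z - k) < e"
    using has_sumE_N[OF f e] by metis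
  obtain Y where Y: "finite Y" "Y \<subseteq> A"
    "\<And>Z. finite Z \<Longrightarrow> Y \<subseteq> Z \<Longrightarrow> Z \<subseteq> A \<Longrightarrow> N (sum g Z - l) < e"
    using has_sumE_N[OF g e] by metis
  have "N ((\<Sum>x\<in>Z. f x + g x) - (k + l)) < e" if "finite Z" "S \<union> Y \<subseteq> Z" "Z \<subseteq> A" for Z
  proof -
    have "N ((sum f Z - k) + (sum g Z - l)) < e"
      by (rule N_add_less) (use that S Y in auto)
    then show ?thesis
      by (simp add: sum.distrib algebra_simps)
  qed
  then show "\<exists>S. finite S \<and> S \<subseteq> A \<and>
      (\<forall>Z. finite Z \<and> S \<subseteq> Z \<and> Z \<subseteq> A \<longrightarrow> N ((\<Sum>x\<in>Z. f x + g x) - (k + l)) < e)"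
    using S Y by (intro exI[of _ "S \<union> Y"]) auto
qed

lemma has_sum_bounded_additive:
  assumes f: "(f has_sum l) A" and add: "Modules.additive T" and bound: "\<And>x. N (T x) \<le> B * N x"
  shows "((\<lambda>x. T (f x)) has_sum T l) A"
  unfolding has_sum_iff_N
proof (intro allI impI)
  fix e :: real
  assume "0 < e"
  then have "0 < e / (\<bar>B\<bar> + 1)"
    by simp
  from has_sumE_N[OF f this] obtain S where S: "finite S" "S \<subseteq> A"
    "\<And>Y. finite Y \<Longrightarrow> S \<subseteq> Y \<Longrightarrow> Y \<subseteq> A \<Longrightarrow> N (sum f Y - l) < e / (\<bar>B\<bar> + 1)"
    by metis
  have "N ((\<Sum>x\<in>Y. T (f x)) - T l) < e" if "finite Y" "S \<subseteq> Y" "Y \<subseteq> A" for Y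
  proof -
    have "N ((\<Sum>x\<in>Y. T (f x)) - T l) = N (T (sum f Y - l))"
      by (simp add: Modules.additive.diff[OF add] Modules.additive.sum[OF add])
    also have "\<dots> \<le> (\<bar>B\<bar> + 1) * N (sum f Y - l)"
      by (rule order_trans[OF bound mult_right_mono]) (auto simp: N_nonneg)
    also have "\<dots> < e"
      using S(3)[OF that] by (simp add: field_simps)
    finally show ?thesis .
  qed
  then show "\<exists>S. finite S \<and> S \<subseteq> A \<and>
      (\<forall>Y. finite Y \<and> S \<subseteq> Y \<and> Y \<subseteq> A \<longrightarrow> N ((\<Sum>x\<in>Y. T (f x)) - T l) < e)"
    using S by blast
qed

text \<open>Non-archimedean Fubini theorem. Only finitely many terms have size at least \<open>e\<close>; as soon as a
  finite set of rows contains all of them, the sum over these rows and the total sum both differ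
  from the sum of the large terms by less than \<open>e\<close>.\<close>

lemma has_sum_Times_iterated:
  assumes van: "vanishing F (A \<times> B)" and l: "(F has_sum l) (A \<times> B)"
    and s: "\<And>a. a \<in> A \<Longrightarrow> ((\<lambda>b. F (a, b)) has_sum s a) B"
  shows "(s has_sum l) A"
  unfolding has_sum_iff_N
proof (intro allI impI)
  fix e :: real
  assume e: "0 < e"
  define P where "P = {p \<in> A \<times> B. e \<le> N (F p)}"
  have P: "finite P" "P \<subseteq> A \<times> B" and small: "\<And>p. p \<in> A \<times> B - P \<Longrightarrow> N (F p) < e"
    using van e unfolding vanishing_def P_def by auto
  have "N (sum s Y - l) < e" if Y: "finite Y" "fst ` P \<subseteq> Y" "Y \<subseteq> A" for Y
  proof -
    define Q where "Q a = {b. (a, b) \<in> P}" for a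
    have Q: "finite (Q a)" for a
      using finite_subset[of "Q a" "snd ` P"] P by (force simp: Q_def)
    have "P = Sigma Y Q"
      using Y by (force simp: Q_def)
    then have "sum F P = (\<Sum>a\<in>Y. \<Sum>b\<in>Q a. F (a, b))"
      using sum.Sigma[of Y Q "\<lambda>a b. F (a, b)"] Y Q by simp
    then have "sum s Y - sum F P = (\<Sum>a\<in>Y. s a - (\<Sum>b\<in>Q a. F (a, b)))"
      by (simp add: sum_subtractf)
    also have "N \<dots> < e"
    proof (rule N_sum_less[OF e])
      fix a
      assume "a \<in> Y"
      with Y have "a \<in> A"
        by blast
      show "N (s a - (\<Sum>b\<in>Q a. F (a, b))) < e"
        by (rule has_sum_diff_less[OF s])
          (use \<open>a \<in> A\<close> e Q P small in \<open>auto simp: Q_def\<close>)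
    qed
    finally have "N (sum s Y - sum F P) < e" .
    moreover have "N (sum F P - l) < e"
      by (subst N_diff_commute) (rule has_sum_diff_less[OF l e P small])
    ultimately show ?thesis
      by (rule N_diff_less_trans)
  qed
  then show "\<exists>S. finite S \<and> S \<subseteq> A \<and>
      (\<forall>Y. finite Y \<and> S \<subseteq> Y \<and> Y \<subseteq> A \<longrightarrow> N (sum s Y - l) < e)"
    using P by (intro exI[of _ "fst ` P"]) force
qed

end


section \<open>The Novikov--Sikorav completion is a ring\<close>

locale group_character = group G for G (structure) +
  fixes \<psi> :: "'a \<Rightarrow> real"
  assumes character_mult: "g \<in> carrier G \<Longrightarrow> h \<in> carrier G \<Longrightarrow> \<psi> (g \<otimes> h) = \<psi> g + \<psi> h"
begin

lemma character_one: "\<psi> \<one> = 0"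
  using character_mult[of \<one> \<one>] by simp

lemma character_inv: "g \<in> carrier G \<Longrightarrow> \<psi> (inv g) = - \<psi> g"
  using character_mult[of g "inv g"] character_one by simp

lemma novikov_eq_zero: "n \<in> carrier (novikov G \<psi>) \<Longrightarrow> g \<notin> carrier G \<Longrightarrow> n g = 0"
  by (simp add: novikov_def)

lemma finite_novikov_support:
  "n \<in> carrier (novikov G \<psi>) \<Longrightarrow> finite {g \<in> carrier G. n g \<noteq> 0 \<and> c \<le> \<psi> g}"
  by (simp add: novikov_def)

lemma in_novikovI:
  assumes "\<And>g. g \<notin> carrier G \<Longrightarrow> n g = 0"
    and "\<And>c. finite {g \<in> carrier G. n g \<noteq> 0 \<and> c \<le> \<psi> g}"
  shows "n \<in> carrier (novikov G \<psi>)"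
  using assms by (simp add: novikov_def)

text \<open>Above \<open>0\<close> the support is finite, and the sum of its (nonnegative) values there is a common bound.\<close>

lemma novikov_support_bounded:
  assumes "n \<in> carrier (novikov G \<psi>)"
  obtains K where "\<And>g. g \<in> carrier G \<Longrightarrow> n g \<noteq> 0 \<Longrightarrow> \<psi> g \<le> K"
proof -
  let ?S = "{g \<in> carrier G. n g \<noteq> 0 \<and> 0 \<le> \<psi> g}"
  have fin: "finite ?S"
    using assms by (rule finite_novikov_support)
  have "\<psi> g \<le> (\<Sum>h\<in>?S. \<psi> h)" if "g \<in> carrier G" "n g \<noteq> 0" for g
  proof (cases "0 \<le> \<psi> g")
    case True
    then show ?thesis
      using that fin by (intro member_le_sum) auto
  next
    case False
    then show ?thesis
      using sum_nonneg[of ?S \<psi>] by auto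
  qed
  then show thesis
    using that by blast
qed

text \<open>The finiteness behind both the convolution product and the double series: each factor is bounded
  above on its support, so a lower bound for \<open>\<psi> h + \<psi> k\<close> is a lower bound for \<open>\<psi> h\<close> and for \<open>\<psi> k\<close>.\<close>

lemma finite_support_pairs:
  assumes m: "m \<in> carrier (novikov G \<psi>)" and n: "n \<in> carrier (novikov G \<psi>)"
  shows "finite {(h, k) \<in> carrier G \<times> carrier G. m h \<noteq> 0 \<and> n k \<noteq> 0 \<and> c \<le> \<psi> h + \<psi> k}"
proof -
  obtain Km where Km: "\<And>g. g \<in> carrier G \<Longrightarrow> m g \<noteq> 0 \<Longrightarrow> \<psi> g \<le> Km"
    using novikov_support_bounded[OF m] by blast
  obtain Kn where Kn: "\<And>g. g \<in> carrier G \<Longrightarrow> n g \<noteq> 0 \<Longrightarrow> \<psi> g \<le> Kn"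
    using novikov_support_bounded[OF n] by blast
  have bounds: "c - Kn \<le> \<psi> h \<and> c - Km \<le> \<psi> k"
    if "h \<in> carrier G" "k \<in> carrier G" "m h \<noteq> 0" "n k \<noteq> 0" "c \<le> \<psi> h + \<psi> k" for h k
    using that Km[of h] Kn[of k] by simp
  show ?thesis
  proof (rule finite_subset)
    show "{(h, k) \<in> carrier G \<times> carrier G. m h \<noteq> 0 \<and> n k \<noteq> 0 \<and> c \<le> \<psi> h + \<psi> k}
      \<subseteq> {h \<in> carrier G. m h \<noteq> 0 \<and> c - Kn \<le> \<psi> h} \<times> {k \<in> carrier G. n k \<noteq> 0 \<and> c - Km \<le> \<psi> k}"
      using bounds by auto
    show "finite ({h \<in> carrier G. m h \<noteq> 0 \<and> c - Kn \<le> \<psi> h} \<times> {k \<in> carrier G. n k \<noteq> 0 \<and> c - Km \<le> \<psi> k})"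
      by (intro finite_cartesian_product finite_novikov_support m n)
  qed
qed

lemma inv_mult_cancel [simp]:
  "h \<in> carrier G \<Longrightarrow> k \<in> carrier G \<Longrightarrow> inv h \<otimes> (h \<otimes> k) = k"
  "h \<in> carrier G \<Longrightarrow> k \<in> carrier G \<Longrightarrow> h \<otimes> (inv h \<otimes> k) = k"
  by (simp_all add: m_assoc[symmetric])

lemma character_inv_mult:
  "h \<in> carrier G \<Longrightarrow> g \<in> carrier G \<Longrightarrow> \<psi> (inv h \<otimes> g) = \<psi> g - \<psi> h"
  by (simp add: character_mult character_inv)

definition convolution_support :: "('a \<Rightarrow> int) \<Rightarrow> ('a \<Rightarrow> int) \<Rightarrow> 'a \<Rightarrow> 'a set" where
  "convolution_support m n g = {h \<in> carrier G. m h \<noteq> 0 \<and> n (inv h \<otimes> g) \<noteq> 0}"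

lemma finite_convolution_support:
  assumes m: "m \<in> carrier (novikov G \<psi>)" and n: "n \<in> carrier (novikov G \<psi>)" and g: "g \<in> carrier G"
  shows "finite (convolution_support m n g)"
proof (rule finite_subset)
  let ?P = "{(h, k) \<in> carrier G \<times> carrier G. m h \<noteq> 0 \<and> n k \<noteq> 0 \<and> \<psi> g \<le> \<psi> h + \<psi> k}"
  show "finite (fst ` ?P)"
    using finite_support_pairs[OF m n] by blast
  show "convolution_support m n g \<subseteq> fst ` ?P"
  proof
    fix h
    assume "h \<in> convolution_support m n g"
    then have "(h, inv h \<otimes> g) \<in> ?P"
      using g by (auto simp: convolution_support_def character_inv_mult)
    then show "h \<in> fst ` ?P"
      by (metis (no_types, lifting) fst_conv image_eqI)
  qed
qed

text \<open>The freedom in the choice of \<open>S\<close> allows several convolutions to be summed over one index set.\<close>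

lemma novikov_mult_eq_sum:
  assumes "g \<in> carrier G" "finite S" "S \<subseteq> carrier G" "convolution_support m n g \<subseteq> S"
  shows "(m \<otimes>\<^bsub>novikov G \<psi>\<^esub> n) g = (\<Sum>h\<in>S. m h * n (inv h \<otimes> g))"
proof -
  have "(\<Sum>h\<in>convolution_support m n g. m h * n (inv h \<otimes> g)) = (\<Sum>h\<in>S. m h * n (inv h \<otimes> g))"
    by (rule sum.mono_neutral_left) (use assms in \<open>auto simp: convolution_support_def\<close>)
  then show ?thesis
    using assms(1) by (simp add: novikov_def convolution_support_def)
qed

lemma novikov_mult_nonzeroE:
  assumes "(m \<otimes>\<^bsub>novikov G \<psi>\<^esub> n) g \<noteq> 0" "g \<in> carrier G"
  obtains h k where "h \<in> carrier G" "k \<in> carrier G" "m h \<noteq> 0" "n k \<noteq> 0" "g = h \<otimes> k"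
proof -
  from assms have "(\<Sum>h\<in>convolution_support m n g. m h * n (inv h \<otimes> g)) \<noteq> 0"
    by (simp add: novikov_def convolution_support_def)
  then obtain h where "h \<in> convolution_support m n g"
    by (metis (no_types, lifting) sum.neutral)
  then show thesis
    using that[of h "inv h \<otimes> g"] assms(2) by (auto simp: convolution_support_def)
qed

lemma novikov_mult_closed:
  assumes m: "m \<in> carrier (novikov G \<psi>)" and n: "n \<in> carrier (novikov G \<psi>)"
  shows "m \<otimes>\<^bsub>novikov G \<psi>\<^esub> n \<in> carrier (novikov G \<psi>)"
proof (rule in_novikovI)
  show "(m \<otimes>\<^bsub>novikov G \<psi>\<^esub> n) g = 0" if "g \<notin> carrier G" for g
    using that by (simp add: novikov_def)
  fix c
  let ?P = "{(h, k) \<in> carrier G \<times> carrier G. m h \<noteq> 0 \<and> n k \<noteq> 0 \<and> c \<le> \<psi> h + \<psi> k}"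
  show "finite {g \<in> carrier G. (m \<otimes>\<^bsub>novikov G \<psi>\<^esub> n) g \<noteq> 0 \<and> c \<le> \<psi> g}"
  proof (rule finite_subset)
    show "finite ((\<lambda>(h, k). h \<otimes> k) ` ?P)"
      by (rule finite_imageI[OF finite_support_pairs[OF m n]])
    show "{g \<in> carrier G. (m \<otimes>\<^bsub>novikov G \<psi>\<^esub> n) g \<noteq> 0 \<and> c \<le> \<psi> g} \<subseteq> (\<lambda>(h, k). h \<otimes> k) ` ?P"
    proof clarify
      fix g
      assume "g \<in> carrier G" "(m \<otimes>\<^bsub>novikov G \<psi>\<^esub> n) g \<noteq> 0" "c \<le> \<psi> g"
      moreover obtain h k where
        "h \<in> carrier G" "k \<in> carrier G" "m h \<noteq> 0" "n k \<noteq> 0" "g = h \<otimes> k"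
        by (rule novikov_mult_nonzeroE) (use calculation in auto)
      ultimately have "(h, k) \<in> ?P" "g = h \<otimes> k"
        by (simp_all add: character_mult)
      then show "g \<in> (\<lambda>(h, k). h \<otimes> k) ` ?P"
        by (metis (no_types, lifting) case_prod_conv image_eqI)
    qed
  qed
qed

lemma novikov_add_closed:
  assumes m: "m \<in> carrier (novikov G \<psi>)" and n: "n \<in> carrier (novikov G \<psi>)"
  shows "m \<oplus>\<^bsub>novikov G \<psi>\<^esub> n \<in> carrier (novikov G \<psi>)"
proof (rule in_novikovI)
  show "(m \<oplus>\<^bsub>novikov G \<psi>\<^esub> n) g = 0" if "g \<notin> carrier G" for g
    using that novikov_eq_zero m n by (simp add: novikov_def)
  show "finite {g \<in> carrier G. (m \<oplus>\<^bsub>novikov G \<psi>\<^esub> n) g \<noteq> 0 \<and> c \<le> \<psi> g}" for c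
    by (rule finite_subset[OF _ finite_UnI[OF finite_novikov_support[OF m] finite_novikov_support[OF n]]])
      (auto simp: novikov_def)
qed

lemma novikov_one_closed: "\<one>\<^bsub>novikov G \<psi>\<^esub> \<in> carrier (novikov G \<psi>)"
  by (rule in_novikovI)
    (auto simp: novikov_def split: if_splits intro: finite_subset[of _ "{\<one>}"])

lemma abelian_group_novikov: "abelian_group (novikov G \<psi>)"
proof (rule abelian_groupI)
  show "\<exists>n\<in>carrier (novikov G \<psi>). n \<oplus>\<^bsub>novikov G \<psi>\<^esub> m = \<zero>\<^bsub>novikov G \<psi>\<^esub>"
    if "m \<in> carrier (novikov G \<psi>)" for m
    using that by (intro bexI[of _ "\<lambda>g. - m g"]) (auto simp: novikov_def)
qed (auto intro: novikov_add_closed, auto simp: novikov_def)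

lemma novikov_l_distr:
  assumes m: "m \<in> carrier (novikov G \<psi>)" and n: "n \<in> carrier (novikov G \<psi>)" and p: "p \<in> carrier (novikov G \<psi>)"
  shows "(m \<oplus>\<^bsub>novikov G \<psi>\<^esub> n) \<otimes>\<^bsub>novikov G \<psi>\<^esub> p =
    (m \<otimes>\<^bsub>novikov G \<psi>\<^esub> p) \<oplus>\<^bsub>novikov G \<psi>\<^esub> (n \<otimes>\<^bsub>novikov G \<psi>\<^esub> p)"
proof
  fix g
  have plus: "(a \<oplus>\<^bsub>novikov G \<psi>\<^esub> b) h = a h + b h" for a b h
    by (simp add: novikov_def)
  show "((m \<oplus>\<^bsub>novikov G \<psi>\<^esub> n) \<otimes>\<^bsub>novikov G \<psi>\<^esub> p) g =
    ((m \<otimes>\<^bsub>novikov G \<psi>\<^esub> p) \<oplus>\<^bsub>novikov G \<psi>\<^esub> (n \<otimes>\<^bsub>novikov G \<psi>\<^esub> p)) g"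
  proof (cases "g \<in> carrier G")
    case g: True
    define S where "S = convolution_support m p g \<union> convolution_support n p g"
    have "finite S" "S \<subseteq> carrier G"
      using finite_convolution_support g m n p by (auto simp: S_def convolution_support_def)
    moreover have "convolution_support (m \<oplus>\<^bsub>novikov G \<psi>\<^esub> n) p g \<subseteq> S"
      by (auto simp: S_def convolution_support_def plus)
    ultimately show ?thesis
      using g by (simp add: novikov_mult_eq_sum[of g S] plus S_def sum.distrib distrib_right)
  next
    case False
    then show ?thesis
      by (simp add: novikov_def)
  qed
qed

lemma novikov_r_distr:
  assumes m: "m \<in> carrier (novikov G \<psi>)" and n: "n \<in> carrier (novikov G \<psi>)" and p: "p \<in> carrier (novikov G \<psi>)"
  shows "p \<otimes>\<^bsub>novikov G \<psi>\<^esub> (m \<oplus>\<^bsub>novikov G \<psi>\<^esub> n) =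
    (p \<otimes>\<^bsub>novikov G \<psi>\<^esub> m) \<oplus>\<^bsub>novikov G \<psi>\<^esub> (p \<otimes>\<^bsub>novikov G \<psi>\<^esub> n)"
proof
  fix g
  have plus: "(a \<oplus>\<^bsub>novikov G \<psi>\<^esub> b) h = a h + b h" for a b h
    by (simp add: novikov_def)
  show "(p \<otimes>\<^bsub>novikov G \<psi>\<^esub> (m \<oplus>\<^bsub>novikov G \<psi>\<^esub> n)) g =
    ((p \<otimes>\<^bsub>novikov G \<psi>\<^esub> m) \<oplus>\<^bsub>novikov G \<psi>\<^esub> (p \<otimes>\<^bsub>novikov G \<psi>\<^esub> n)) g"
  proof (cases "g \<in> carrier G")
    case g: True
    define S where "S = convolution_support p m g \<union> convolution_support p n g"
    have "finite S" "S \<subseteq> carrier G"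
      using finite_convolution_support g m n p by (auto simp: S_def convolution_support_def)
    moreover have "convolution_support p (m \<oplus>\<^bsub>novikov G \<psi>\<^esub> n) g \<subseteq> S"
      by (auto simp: S_def convolution_support_def plus)
    ultimately show ?thesis
      using g by (simp add: novikov_mult_eq_sum[of g S] plus S_def sum.distrib distrib_left)
  next
    case False
    then show ?thesis
      by (simp add: novikov_def)
  qed
qed

text \<open>Both iterated products at \<open>g\<close> are sums of \<open>m k * n l * p (inv (k \<otimes> l) \<otimes> g)\<close>. A nonzero summand has
  \<open>\<psi> k + \<psi> l + \<psi> (inv (k \<otimes> l) \<otimes> g) = \<psi> g\<close>, so upper bounds for \<open>\<psi>\<close> on the three supports confine
  \<open>k\<close> and \<open>l\<close> to finite sets; over these the two finite sums can be interchanged.\<close>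

lemma novikov_assoc:
  assumes m: "m \<in> carrier (novikov G \<psi>)" and n: "n \<in> carrier (novikov G \<psi>)" and p: "p \<in> carrier (novikov G \<psi>)"
  shows "(m \<otimes>\<^bsub>novikov G \<psi>\<^esub> n) \<otimes>\<^bsub>novikov G \<psi>\<^esub> p = m \<otimes>\<^bsub>novikov G \<psi>\<^esub> (n \<otimes>\<^bsub>novikov G \<psi>\<^esub> p)"
proof
  fix g
  let ?mn = "m \<otimes>\<^bsub>novikov G \<psi>\<^esub> n" and ?np = "n \<otimes>\<^bsub>novikov G \<psi>\<^esub> p"
  show "(?mn \<otimes>\<^bsub>novikov G \<psi>\<^esub> p) g = (m \<otimes>\<^bsub>novikov G \<psi>\<^esub> ?np) g"
  proof (cases "g \<in> carrier G")
    case g: True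
    obtain Km where Km: "\<And>g. g \<in> carrier G \<Longrightarrow> m g \<noteq> 0 \<Longrightarrow> \<psi> g \<le> Km"
      using novikov_support_bounded[OF m] by blast
    obtain Kn where Kn: "\<And>g. g \<in> carrier G \<Longrightarrow> n g \<noteq> 0 \<Longrightarrow> \<psi> g \<le> Kn"
      using novikov_support_bounded[OF n] by blast
    obtain Kp where Kp: "\<And>g. g \<in> carrier G \<Longrightarrow> p g \<noteq> 0 \<Longrightarrow> \<psi> g \<le> Kp"
      using novikov_support_bounded[OF p] by blast
    define S where "S = {k \<in> carrier G. m k \<noteq> 0 \<and> \<psi> g - Kn - Kp \<le> \<psi> k}"
    define U where "U = {l \<in> carrier G. n l \<noteq> 0 \<and> \<psi> g - Km - Kp \<le> \<psi> l}"
    define H where "H = (\<lambda>(k, l). k \<otimes> l) ` (S \<times> U)"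
    have S: "finite S" "S \<subseteq> carrier G" and U: "finite U" "U \<subseteq> carrier G"
      using finite_novikov_support m n by (auto simp: S_def U_def)
    then have H: "finite H" "H \<subseteq> carrier G"
      by (auto simp: H_def)
    have factors: "k \<in> S \<and> l \<in> U"
      if "k \<in> carrier G" "l \<in> carrier G" "m k \<noteq> 0" "n l \<noteq> 0" "p (inv (k \<otimes> l) \<otimes> g) \<noteq> 0" for k l
      using that Km[of k] Kn[of l] Kp[of "inv (k \<otimes> l) \<otimes> g"] g
      by (auto simp: S_def U_def character_inv character_mult)
    have "(?mn \<otimes>\<^bsub>novikov G \<psi>\<^esub> p) g = (\<Sum>h\<in>H. ?mn h * p (inv h \<otimes> g))"
    proof (rule novikov_mult_eq_sum[OF g H], rule subsetI)
      fix h
      assume "h \<in> convolution_support ?mn p g"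
      then have h: "?mn h \<noteq> 0" "h \<in> carrier G" "p (inv h \<otimes> g) \<noteq> 0"
        by (auto simp: convolution_support_def)
      then obtain k l where "k \<in> carrier G" "l \<in> carrier G" "m k \<noteq> 0" "n l \<noteq> 0" "h = k \<otimes> l"
        using novikov_mult_nonzeroE by metis
      with h factors[of k l] show "h \<in> H"
        by (force simp: H_def)
    qed
    also have "\<dots> = (\<Sum>h\<in>H. (\<Sum>k\<in>S. m k * n (inv k \<otimes> h)) * p (inv h \<otimes> g))"
    proof (rule sum.cong[OF refl])
      fix h
      assume "h \<in> H"
      then have h: "h \<in> carrier G"
        using H by blast
      show "?mn h * p (inv h \<otimes> g) = (\<Sum>k\<in>S. m k * n (inv k \<otimes> h)) * p (inv h \<otimes> g)"
      proof (cases "p (inv h \<otimes> g) = 0")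
        case False
        have "k \<in> S" if "k \<in> convolution_support m n h" for k
          using that False h factors[of k "inv k \<otimes> h"] by (simp add: convolution_support_def)
        then have "convolution_support m n h \<subseteq> S"
          by blast
        then show ?thesis
          by (simp add: novikov_mult_eq_sum[OF h S])
      qed simp
    qed
    also have "\<dots> = (\<Sum>k\<in>S. m k * (\<Sum>h\<in>H. n (inv k \<otimes> h) * p (inv h \<otimes> g)))"
      unfolding sum_distrib_right sum_distrib_left mult.assoc by (rule sum.swap)
    also have "\<dots> = (\<Sum>k\<in>S. m k * ?np (inv k \<otimes> g))"
    proof (rule sum.cong[OF refl])
      fix k
      assume kS: "k \<in> S"
      then have k: "k \<in> carrier G" "m k \<noteq> 0"
        by (auto simp: S_def)
      \<comment> \<open>Translation by \<open>k\<close> matches the index set \<open>H\<close> for \<open>h = k \<otimes> l\<close> with one for \<open>l\<close>.\<close>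
      define L where "L = (\<lambda>h. inv k \<otimes> h) ` H"
      have L: "finite L" "L \<subseteq> carrier G"
        using H k by (auto simp: L_def)
      have "convolution_support n p (inv k \<otimes> g) \<subseteq> L"
      proof
        fix l
        assume "l \<in> convolution_support n p (inv k \<otimes> g)"
        then have l: "l \<in> carrier G" "n l \<noteq> 0" "p (inv (k \<otimes> l) \<otimes> g) \<noteq> 0"
          using k g by (auto simp: convolution_support_def inv_mult_group m_assoc)
        then have "k \<otimes> l \<in> H"
          using factors[of k l] k by (force simp: H_def)
        then show "l \<in> L"
          unfolding L_def using k l by (intro image_eqI[of _ _ "k \<otimes> l"]) auto
      qed
      then have "?np (inv k \<otimes> g) = (\<Sum>l\<in>L. n l * p (inv l \<otimes> (inv k \<otimes> g)))"
        using k g by (intro novikov_mult_eq_sum L) auto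
      also have "\<dots> = (\<Sum>h\<in>H. n (inv k \<otimes> h) * p (inv h \<otimes> g))"
        unfolding L_def
      proof (subst sum.reindex)
        show "inj_on (\<lambda>h. inv k \<otimes> h) H"
        proof (rule inj_on_inverseI)
          show "k \<otimes> (inv k \<otimes> h) = h" if "h \<in> H" for h
            using that H k by (intro inv_mult_cancel) auto
        qed
        show "sum ((\<lambda>l. n l * p (inv l \<otimes> (inv k \<otimes> g))) \<circ> (\<lambda>h. inv k \<otimes> h)) H =
          (\<Sum>h\<in>H. n (inv k \<otimes> h) * p (inv h \<otimes> g))"
        proof (rule sum.cong[OF refl])
          fix h
          assume "h \<in> H"
          then have "h \<in> carrier G"
            using H by blast
          then show "((\<lambda>l. n l * p (inv l \<otimes> (inv k \<otimes> g))) \<circ> (\<lambda>h. inv k \<otimes> h)) h =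
            n (inv k \<otimes> h) * p (inv h \<otimes> g)"
            using k g by (simp add: inv_mult_group m_assoc)
        qed
      qed
      finally show "m k * (\<Sum>h\<in>H. n (inv k \<otimes> h) * p (inv h \<otimes> g)) = m k * ?np (inv k \<otimes> g)"
        by simp
    qed
    also have "\<dots> = (m \<otimes>\<^bsub>novikov G \<psi>\<^esub> ?np) g"
    proof (rule novikov_mult_eq_sum[OF g S, symmetric], rule subsetI)
      fix k
      assume "k \<in> convolution_support m ?np g"
      then have k: "k \<in> carrier G" "m k \<noteq> 0" "?np (inv k \<otimes> g) \<noteq> 0"
        by (auto simp: convolution_support_def)
      then obtain l q where l: "l \<in> carrier G" "q \<in> carrier G" "n l \<noteq> 0" "p q \<noteq> 0" "inv k \<otimes> g = l \<otimes> q"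
        using novikov_mult_nonzeroE g by (metis inv_closed m_closed)
      then have "\<psi> g - \<psi> k = \<psi> l + \<psi> q"
        using k g by (metis character_inv_mult character_mult)
      then show "k \<in> S"
        using k l Kn[of l] Kp[of q] by (auto simp: S_def)
    qed
    finally show ?thesis .
  next
    case False
    then show ?thesis
      by (simp add: novikov_def)
  qed
qed

lemma novikov_one_left:
  assumes "n \<in> carrier (novikov G \<psi>)"
  shows "\<one>\<^bsub>novikov G \<psi>\<^esub> \<otimes>\<^bsub>novikov G \<psi>\<^esub> n = n"
proof
  fix g
  show "(\<one>\<^bsub>novikov G \<psi>\<^esub> \<otimes>\<^bsub>novikov G \<psi>\<^esub> n) g = n g"
  proof (cases "g \<in> carrier G")
    case True
    then have "(\<one>\<^bsub>novikov G \<psi>\<^esub> \<otimes>\<^bsub>novikov G \<psi>\<^esub> n) g =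
        (\<Sum>h\<in>{\<one>}. \<one>\<^bsub>novikov G \<psi>\<^esub> h * n (inv h \<otimes> g))"
      by (intro novikov_mult_eq_sum) (auto simp: convolution_support_def novikov_def split: if_splits)
    with True show ?thesis
      by (simp add: novikov_def)
  next
    case False
    with assms show ?thesis
      by (simp add: novikov_def)
  qed
qed

lemma novikov_one_right:
  assumes "n \<in> carrier (novikov G \<psi>)"
  shows "n \<otimes>\<^bsub>novikov G \<psi>\<^esub> \<one>\<^bsub>novikov G \<psi>\<^esub> = n"
proof
  fix g
  show "(n \<otimes>\<^bsub>novikov G \<psi>\<^esub> \<one>\<^bsub>novikov G \<psi>\<^esub>) g = n g"
  proof (cases "g \<in> carrier G")
    case True
    have "h = g" if "h \<in> carrier G" "inv h \<otimes> g = \<one>" for h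
      using that True by (metis inv_equality inv_inv inv_closed)
    with True have "(n \<otimes>\<^bsub>novikov G \<psi>\<^esub> \<one>\<^bsub>novikov G \<psi>\<^esub>) g =
        (\<Sum>h\<in>{g}. n h * \<one>\<^bsub>novikov G \<psi>\<^esub> (inv h \<otimes> g))"
      by (intro novikov_mult_eq_sum) (auto simp: convolution_support_def novikov_def split: if_splits)
    with True show ?thesis
      by (simp add: novikov_def)
  next
    case False
    with assms show ?thesis
      by (simp add: novikov_def)
  qed
qed

theorem ring_novikov: "Ring.ring (novikov G \<psi>)"
  by (intro Ring.ringI abelian_group_novikov monoidI novikov_mult_closed novikov_one_closed
      novikov_assoc novikov_one_left novikov_one_right novikov_l_distr novikov_r_distr)

end



section \<open>Non-archimedean fields and coordinate spaces\<close>

locale ultrametric_field =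
  fixes av :: "'h::{field, complete_space} \<Rightarrow> real"
  assumes av_mult: "av (x * y) = av x * av y"
    and av_add: "av (x + y) \<le> max (av x) (av y)"
    and dist_eq_av: "dist x y = av (x - y)"
begin

lemma av_nonneg: "0 \<le> av x"
  using zero_le_dist[of x 0] by (simp add: dist_eq_av)

lemma av_zero [simp]: "av 0 = 0"
  using dist_eq_av[of 0 0] by simp

lemma av_uminus [simp]: "av (- x) = av x"
  using dist_commute[of 0 x] by (simp add: dist_eq_av)

lemma av_one [simp]: "av 1 = 1"
proof -
  have "av 1 \<noteq> 0"
    using dist_eq_0_iff[of "1::'h" 0] by (simp add: dist_eq_av)
  moreover have "av 1 * av 1 = av 1"
    using av_mult[of 1 1] by simp
  ultimately show ?thesis
    by simp
qed

lemma av_of_int_le_1: "av (of_int k) \<le> 1"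
proof (induction k rule: int_induct[where k = 0])
  case (step1 k)
  then show ?case
    using av_add[of "of_int k" 1] by simp
next
  case (step2 k)
  then show ?case
    using av_add[of "of_int k" "- 1"] by simp
qed simp

lemma av_sum_le:
  assumes "0 \<le> c" "\<And>b. b \<in> S \<Longrightarrow> av (f b) \<le> c"
  shows "av (sum f S) \<le> c"
  using assms(2)
proof (induction S rule: infinite_finite_induct)
  case (insert b S)
  then have "av (f b) \<le> c" "av (sum f S) \<le> c"
    by auto
  with insert.hyps show ?case
    using av_add[of "f b" "sum f S"] by simp
qed (use assms(1) in auto)

definition sup_abs :: "'h ^ 'r \<Rightarrow> real" where
  "sup_abs x = Max (range (\<lambda>a. av (x $ a)))"

lemma sup_abs_le_iff:
  fixes x :: "'h ^ 'r"
  shows "sup_abs x \<le> c \<longleftrightarrow> (\<forall>a. av (x $ a) \<le> c)"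
  by (simp add: sup_abs_def)

lemma av_nth_le_sup_abs:
  fixes x :: "'h ^ 'r"
  shows "av (x $ a) \<le> sup_abs x"
  using sup_abs_le_iff by blast

lemma sup_abs_nonneg: "0 \<le> sup_abs x"
  using av_nonneg av_nth_le_sup_abs by (rule order_trans)

lemma ultrametric_group_sup_abs:
  "ultrametric_group (sup_abs :: 'h ^ 'r \<Rightarrow> real) (real CARD('r))"
proof
  fix x y :: "'h ^ 'r"
  show "0 < real CARD('r)"
    by simp
  have "av ((x - y) $ a) \<le> dist x y" for a
    using dist_vec_nth_le[of x a y] by (simp add: dist_eq_av)
  then show "sup_abs (x - y) \<le> dist x y"
    by (simp add: sup_abs_le_iff)
  have "dist x y \<le> (\<Sum>a\<in>UNIV. dist (x $ a) (y $ a))"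
    unfolding dist_vec_def by (rule L2_set_le_sum) simp
  also have "\<dots> \<le> (\<Sum>a\<in>(UNIV :: 'r set). sup_abs (x - y))"
    using av_nth_le_sup_abs[of "x - y"] by (intro sum_mono) (simp add: dist_eq_av)
  finally show "dist x y \<le> real CARD('r) * sup_abs (x - y)"
    by simp
  have "av ((x + y) $ a) \<le> max (sup_abs x) (sup_abs y)" for a
    using av_add[of "x $ a" "y $ a"] av_nth_le_sup_abs[of x a] av_nth_le_sup_abs[of y a]
    by (simp add: max_def split: if_splits)
  then show "sup_abs (x + y) \<le> max (sup_abs x) (sup_abs y)"
    by (simp add: sup_abs_le_iff)
  show "sup_abs (- x) = sup_abs x"
    by (simp add: sup_abs_def)
qed

lemma sup_abs_of_int_scale_le: "sup_abs (of_int k *s x) \<le> sup_abs x"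
proof -
  have "av (of_int k) * av (x $ a) \<le> 1 * sup_abs x" for a
    by (intro mult_mono av_of_int_le_1 av_nth_le_sup_abs) (auto simp: av_nonneg)
  then show ?thesis
    by (simp add: sup_abs_le_iff av_mult)
qed

lemma sup_abs_matrix_vector_le:
  fixes A :: "'h ^ 'r ^ 'm"
  assumes "\<And>a b. av (A $ a $ b) \<le> c"
  shows "sup_abs (A *v x) \<le> c * sup_abs x"
proof -
  have "0 \<le> c"
    using av_nonneg assms by (rule order_trans)
  have "av (\<Sum>b\<in>UNIV. A $ a $ b * x $ b) \<le> c * sup_abs x" for a
    by (rule av_sum_le)
      (auto simp: av_mult av_nonneg sup_abs_nonneg \<open>0 \<le> c\<close> intro!: mult_mono assms av_nth_le_sup_abs)
  then show ?thesis
    by (simp add: sup_abs_le_iff matrix_vector_mult_def)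
qed

end

section \<open>Modules from representations of exponential growth\<close>

lemma exp_le_imp_bounded_below:
  fixes e c \<alpha> :: real
  assumes "0 < e" "0 \<le> c" "0 < \<alpha>"
  obtains t where "\<And>s. e \<le> c * exp (\<alpha> * s) \<Longrightarrow> t \<le> s"
proof
  fix s
  (* Replacing c by c + 1 makes the division possible when c = 0. *)
  assume "e \<le> c * exp (\<alpha> * s)"
  also have "\<dots> \<le> (c + 1) * exp (\<alpha> * s)"
    by simp
  finally have "e / (c + 1) \<le> exp (\<alpha> * s)"
    using assms by (simp add: field_simps)
  moreover have "0 < e / (c + 1)"
    using assms by simp
  ultimately have "ln (e / (c + 1)) \<le> \<alpha> * s"
    using ln_le_cancel_iff[of "e / (c + 1)" "exp (\<alpha> * s)"] by simp
  then show "ln (e / (c + 1)) / \<alpha> \<le> s"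
    using assms by (simp add: field_simps)
qed

text \<open>The growth condition on \<open>M\<close> is what lets a Novikov series act: along an infinite support of a Novikov
  series \<open>\<psi>\<close> tends to \<open>-\<infinity>\<close>, and with it the entries of \<open>M\<close> tend to \<open>0\<close>.\<close>

locale bounded_representation =
  group_character G \<psi> + ultrametric_field av
  for G :: "('g, 'b) monoid_scheme" (structure) and \<psi>
    and av :: "'h::{field, complete_space} \<Rightarrow> real" +
  fixes M :: "'g \<Rightarrow> 'h ^ 'r ^ 'r" and c \<alpha> :: real
  assumes M_mult: "g \<in> carrier G \<Longrightarrow> h \<in> carrier G \<Longrightarrow> M (g \<otimes> h) = M g ** M h"
    and M_one: "M \<one> = mat 1"
    and \<alpha>_pos: "0 < \<alpha>"
    and entry_bound: "g \<in> carrier G \<Longrightarrow> av (M g $ a $ b) \<le> c * exp (\<alpha> * \<psi> g)"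
begin

sublocale ultrametric_group "sup_abs :: 'h ^ 'r \<Rightarrow> real" "real CARD('r)"
  by (rule ultrametric_group_sup_abs)

definition series_term :: "('g \<Rightarrow> int) \<Rightarrow> 'h ^ 'r \<Rightarrow> 'g \<Rightarrow> 'h ^ 'r" where
  "series_term n x g = of_int (n g) *s (M g *v x)"

definition act :: "('g \<Rightarrow> int) \<Rightarrow> 'h ^ 'r \<Rightarrow> 'h ^ 'r" where
  "act n x = infsum (series_term n x) (carrier G)"

lemma c_nonneg: "0 \<le> c"
  using order_trans[OF av_nonneg entry_bound[of \<one>]] by (simp add: zero_le_mult_iff)

lemma term_bound:
  assumes "g \<in> carrier G"
  shows "sup_abs (of_int k *s (M g *v x)) \<le> c * sup_abs x * exp (\<alpha> * \<psi> g)"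
proof -
  have "sup_abs (of_int k *s (M g *v x)) \<le> sup_abs (M g *v x)"
    by (rule sup_abs_of_int_scale_le)
  also have "\<dots> \<le> c * exp (\<alpha> * \<psi> g) * sup_abs x"
    by (intro sup_abs_matrix_vector_le entry_bound assms)
  finally show ?thesis
    by (simp add: ac_simps)
qed

text \<open>The integer coefficient only matters through being nonzero, and the threshold \<open>t\<close> depends neither
  on it nor on \<open>g\<close>. This uniformity serves single and double series alike.\<close>

lemma bounded_below_of_term_large:
  assumes "0 < e"
  obtains t where
    "\<And>g k. g \<in> carrier G \<Longrightarrow> e \<le> sup_abs (of_int k *s (M g *v x)) \<Longrightarrow> k \<noteq> 0 \<and> t \<le> \<psi> g"
proof -
  obtain t where t: "\<And>s. e \<le> c * sup_abs x * exp (\<alpha> * s) \<Longrightarrow> t \<le> s"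
    using exp_le_imp_bounded_below[OF assms _ \<alpha>_pos, of "c * sup_abs x"] c_nonneg sup_abs_nonneg
    by (metis mult_nonneg_nonneg)
  have "k \<noteq> 0 \<and> t \<le> \<psi> g"
    if "g \<in> carrier G" "e \<le> sup_abs (of_int k *s (M g *v x))" for g k
    using t[OF order_trans[OF that(2) term_bound[OF that(1)]]] that(2) assms by auto
  then show thesis
    by (rule that)
qed

lemma vanishing_series_term:
  assumes "n \<in> carrier (novikov G \<psi>)"
  shows "vanishing (series_term n x) (carrier G)"
  unfolding vanishing_def
proof (intro allI impI)
  fix e :: real
  assume "0 < e"
  then obtain t where
    "\<And>g k. g \<in> carrier G \<Longrightarrow> e \<le> sup_abs (of_int k *s (M g *v x)) \<Longrightarrow> k \<noteq> 0 \<and> t \<le> \<psi> g"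
    using bounded_below_of_term_large by metis
  then have "{g \<in> carrier G. e \<le> sup_abs (series_term n x g)}
      \<subseteq> {g \<in> carrier G. n g \<noteq> 0 \<and> t \<le> \<psi> g}"
    by (auto simp: series_term_def)
  then show "finite {g \<in> carrier G. e \<le> sup_abs (series_term n x g)}"
    using finite_novikov_support[OF assms] by (rule finite_subset)
qed

lemma has_sum_act:
  assumes "n \<in> carrier (novikov G \<psi>)"
  shows "(series_term n x has_sum act n x) (carrier G)"
  unfolding act_def
  by (intro has_sum_infsum vanishing_imp_summable_on vanishing_series_term assms)

lemma vanishing_double_series:
  assumes m: "m \<in> carrier (novikov G \<psi>)" and n: "n \<in> carrier (novikov G \<psi>)"
  shows "vanishing (\<lambda>(h, k). of_int (m h * n k) *s (M (h \<otimes> k) *v x)) (carrier G \<times> carrier G)"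
  unfolding vanishing_def
proof (intro allI impI)
  fix e :: real
  assume "0 < e"
  then obtain t where t:
    "\<And>g k. g \<in> carrier G \<Longrightarrow> e \<le> sup_abs (of_int k *s (M g *v x)) \<Longrightarrow> k \<noteq> 0 \<and> t \<le> \<psi> g"
    using bounded_below_of_term_large by metis
  let ?L = "{p \<in> carrier G \<times> carrier G.
    e \<le> sup_abs (case p of (h, k) \<Rightarrow> of_int (m h * n k) *s (M (h \<otimes> k) *v x))}"
  let ?R = "{(h, k) \<in> carrier G \<times> carrier G. m h \<noteq> 0 \<and> n k \<noteq> 0 \<and> t \<le> \<psi> h + \<psi> k}"
  have "m h * n k \<noteq> 0 \<and> t \<le> \<psi> h + \<psi> k"
    if "h \<in> carrier G" "k \<in> carrier G" "e \<le> sup_abs (of_int (m h * n k) *s (M (h \<otimes> k) *v x))"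
    for h k
    using t[OF m_closed[OF that(1,2)] that(3)] that(1,2) by (simp add: character_mult)
  then have "?L \<subseteq> ?R"
    by (auto simp del: of_int_mult)
  then show "finite ?L"
    using finite_support_pairs[OF m n] by (rule finite_subset)
qed

text \<open>The double series \<open>F\<close> is summed by rows \<open>h\<close> and, after the substitution \<open>k = inv h \<otimes> g\<close>, by
  products \<open>g\<close>. In the second order each inner sum is finite and equals the coefficient of the
  convolution times \<open>M g *v x\<close>.\<close>

lemma act_mult:
  assumes m: "m \<in> carrier (novikov G \<psi>)" and n: "n \<in> carrier (novikov G \<psi>)"
  shows "act (m \<otimes>\<^bsub>novikov G \<psi>\<^esub> n) x = act m (act n x)"
proof -
  define F where "F = (\<lambda>(h, k). of_int (m h * n k) *s (M (h \<otimes> k) *v x))"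
  have van: "vanishing F (carrier G \<times> carrier G)"
    unfolding F_def using m n by (rule vanishing_double_series)
  then obtain l where l: "(F has_sum l) (carrier G \<times> carrier G)"
    using vanishing_imp_summable_on unfolding summable_on_def by blast

  \<comment> \<open>Row \<open>h\<close> is the image of the series of \<open>act n x\<close> under the bounded map \<open>y \<mapsto> m h M h y\<close>.\<close>
  have "((\<lambda>k. F (h, k)) has_sum series_term m (act n x) h) (carrier G)" if h: "h \<in> carrier G" for h
  proof -
    let ?T = "\<lambda>y. of_int (m h) *s (M h *v y)"
    have "((\<lambda>k. ?T (series_term n x k)) has_sum ?T (act n x)) (carrier G)"
    proof (rule has_sum_bounded_additive[OF has_sum_act[OF n]])
      show "Modules.additive ?T"
        by unfold_locales (simp add: matrix_vector_right_distrib)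
      show "sup_abs (?T y) \<le> c * exp (\<alpha> * \<psi> h) * sup_abs y" for y
        using term_bound[OF h, of "m h" y] by (simp add: ac_simps)
    qed
    moreover have "?T (series_term n x k) = F (h, k)" if "k \<in> carrier G" for k
      using h that
      by (simp add: F_def series_term_def M_mult matrix_vector_mul_assoc vector_scalar_commute
          vector_smult_assoc)
    ultimately have "((\<lambda>k. F (h, k)) has_sum ?T (act n x)) (carrier G)"
      by (simp cong: has_sum_cong)
    then show ?thesis
      by (simp add: series_term_def)
  qed
  then have "(series_term m (act n x) has_sum l) (carrier G)"
    by (rule has_sum_Times_iterated[OF van l])
  then have 1: "act m (act n x) = l"
    unfolding act_def by (rule infsumI)

  define F' where "F' = (\<lambda>(g, h). F (h, inv h \<otimes> g))"
  have bij: "bij_betw (\<lambda>(g, h). (h, inv h \<otimes> g)) (carrier G \<times> carrier G) (carrier G \<times> carrier G)"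
    by (rule bij_betw_byWitness[where f' = "\<lambda>(h, k). (h \<otimes> k, h)"]) auto
  have l': "(F' has_sum l) (carrier G \<times> carrier G)"
    using l has_sum_reindex_bij_betw[OF bij, of F l] by (simp add: F'_def case_prod_unfold)
  have van': "vanishing F' (carrier G \<times> carrier G)"
    unfolding vanishing_def
  proof (intro allI impI)
    fix e :: real
    assume "0 < e"
    then have "finite {p \<in> carrier G \<times> carrier G. e \<le> sup_abs (F p)}" (is "finite ?S")
      using van unfolding vanishing_def by blast
    then have "finite ((\<lambda>(h, k). (h \<otimes> k, h)) ` ?S)"
      by (rule finite_imageI)
    moreover have "{p \<in> carrier G \<times> carrier G. e \<le> sup_abs (F' p)} \<subseteq> (\<lambda>(h, k). (h \<otimes> k, h)) ` ?S"
    proof clarify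
      fix g h
      assume "g \<in> carrier G" "h \<in> carrier G" "e \<le> sup_abs (F' (g, h))"
      then show "(g, h) \<in> (\<lambda>(h, k). (h \<otimes> k, h)) ` ?S"
        by (intro image_eqI[of _ _ "(h, inv h \<otimes> g)"]) (simp_all add: F'_def)
    qed
    ultimately show "finite {p \<in> carrier G \<times> carrier G. e \<le> sup_abs (F' p)}"
      by (rule rev_finite_subset)
  qed
  have "((\<lambda>h. F' (g, h)) has_sum series_term (m \<otimes>\<^bsub>novikov G \<psi>\<^esub> n) x g) (carrier G)"
    if g: "g \<in> carrier G" for g
  proof (rule has_sum_finite_neutralI)
    let ?S = "convolution_support m n g"
    show fin: "finite ?S" and sub: "?S \<subseteq> carrier G"
      using finite_convolution_support[OF m n g] by (auto simp: convolution_support_def)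
    have F': "F' (g, h) = of_int (m h * n (inv h \<otimes> g)) *s (M g *v x)" if "h \<in> carrier G" for h
      using g that by (simp add: F'_def F_def)
    then show "F' (g, h) = 0" if "h \<in> carrier G - ?S" for h
      using that by (auto simp: convolution_support_def)
    have "(m \<otimes>\<^bsub>novikov G \<psi>\<^esub> n) g = (\<Sum>h\<in>?S. m h * n (inv h \<otimes> g))"
      using g fin sub by (rule novikov_mult_eq_sum) simp
    then show "series_term (m \<otimes>\<^bsub>novikov G \<psi>\<^esub> n) x g = (\<Sum>h\<in>?S. F' (g, h))"
      using F' sub by (simp add: series_term_def vec.scale_sum_left subset_iff)
  qed
  then have "(series_term (m \<otimes>\<^bsub>novikov G \<psi>\<^esub> n) x has_sum l) (carrier G)"
    by (rule has_sum_Times_iterated[OF van' l'])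
  then have "act (m \<otimes>\<^bsub>novikov G \<psi>\<^esub> n) x = l"
    unfolding act_def by (rule infsumI)
  with 1 show ?thesis
    by simp
qed

lemma act_add_left:
  assumes "m \<in> carrier (novikov G \<psi>)" "n \<in> carrier (novikov G \<psi>)"
  shows "act (m \<oplus>\<^bsub>novikov G \<psi>\<^esub> n) x = act m x + act n x"
proof -
  have "series_term (m \<oplus>\<^bsub>novikov G \<psi>\<^esub> n) x = (\<lambda>g. series_term m x g + series_term n x g)"
    by (auto simp: series_term_def novikov_def vec.scale_left_distrib)
  with has_sum_add_N[OF has_sum_act[OF assms(1), of x] has_sum_act[OF assms(2), of x]]
  show ?thesis
    by (simp add: act_def[of "_ \<oplus>\<^bsub>_\<^esub> _"] infsumI)
qed

lemma act_add_right:
  assumes "n \<in> carrier (novikov G \<psi>)"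
  shows "act n (x + y) = act n x + act n y"
proof -
  have "series_term n (x + y) = (\<lambda>g. series_term n x g + series_term n y g)"
    by (auto simp: series_term_def matrix_vector_right_distrib)
  with has_sum_add_N[OF has_sum_act[OF assms, of x] has_sum_act[OF assms, of y]]
  show ?thesis
    by (simp add: act_def[of _ "_ + _"] infsumI)
qed

lemma act_one: "act \<one>\<^bsub>novikov G \<psi>\<^esub> x = x"
  unfolding act_def
  by (rule infsumI, rule has_sum_finite_neutralI[where B = "{\<one>}"])
    (auto simp: series_term_def novikov_def M_one)

theorem left_module_act: "left_module (novikov G \<psi>) (vec_module act)"
proof (intro left_module.intro left_module_axioms.intro ring_novikov)
  show "abelian_group (vec_module act)"
    by (rule abelian_groupI) (auto simp: vec_module_def add_eq_0_iff intro: exI[of _ "- _"])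
qed (simp_all add: vec_module_def act_add_left act_add_right act_mult act_one)

end



section \<open>Valuations and twisted representations\<close>

locale valuation =
  fixes v :: "'a::field \<Rightarrow> ereal"
  assumes is_valuation: "is_valuation v"
begin

lemma v_zero [simp]: "v 0 = \<infinity>"
  and v_finite: "x \<noteq> 0 \<Longrightarrow> \<bar>v x\<bar> \<noteq> \<infinity>"
  and v_mult: "v (x * y) = v x + v y"
  and v_add: "min (v x) (v y) \<le> v (x + y)"
  using is_valuation by (auto simp: is_valuation_def)

lemma real_v_mult:
  "x \<noteq> 0 \<Longrightarrow> y \<noteq> 0 \<Longrightarrow>
    real_of_ereal (v (x * y)) = real_of_ereal (v x) + real_of_ereal (v y)"
  using v_finite[of x] v_finite[of y] by (simp add: v_mult real_of_ereal_add)

lemma real_v_one: "real_of_ereal (v 1) = 0"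
  using real_v_mult[of 1 1] by simp

lemma real_v_power:
  assumes "x \<noteq> 0"
  shows "real_of_ereal (v (x ^ n)) = real n * real_of_ereal (v x)"
proof (induction n)
  case (Suc n)
  then show ?case
    using assms by (simp add: real_v_mult distrib_right)
qed (simp add: real_v_one)

lemma val_abs_antimono:
  assumes "v x \<le> v y"
  shows "val_abs v y \<le> val_abs v x"
proof (cases "y = 0")
  case True
  then show ?thesis
    by (simp add: val_abs_def)
next
  case False
  then have "\<bar>v y\<bar> \<noteq> \<infinity>"
    by (rule v_finite)
  moreover from this assms have "x \<noteq> 0"
    by auto
  moreover from this have "\<bar>v x\<bar> \<noteq> \<infinity>"
    by (rule v_finite)
  ultimately show ?thesis
    using assms False by (auto simp: val_abs_def elim: ereal_cases)
qed

lemma val_abs_mult: "val_abs v (x * y) = val_abs v x * val_abs v y"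
  by (auto simp: val_abs_def real_v_mult exp_add[symmetric])

lemma val_abs_add: "val_abs v (x + y) \<le> max (val_abs v x) (val_abs v y)"
proof (cases "v x \<le> v y")
  case True
  then have "v x \<le> v (x + y)"
    using v_add[of x y] by (simp add: min_def)
  from val_abs_antimono[OF this] show ?thesis
    by simp
next
  case False
  then have "v y \<le> v (x + y)"
    using v_add[of x y] by (simp add: min_def)
  from val_abs_antimono[OF this] show ?thesis
    by simp
qed

lemma val_abs_le_exp:
  assumes "ereal d \<le> v x"
  shows "val_abs v x \<le> exp (- d)"
proof (cases "x = 0")
  case False
  then obtain t where "v x = ereal t"
    using v_finite[of x] by (cases "v x") auto
  with False assms show ?thesis
    by (simp add: val_abs_def)
qed (simp add: val_abs_def)

end

locale field_embedding =
  fixes f :: "'a::field \<Rightarrow> 'b::field"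
  assumes f_add: "f (x + y) = f x + f y"
    and f_mult: "f (x * y) = f x * f y"
    and f_one: "f 1 = 1"
begin

sublocale Modules.additive f
  by unfold_locales (rule f_add)

lemma f_prod: "f (prod g S) = (\<Prod>x\<in>S. f (g x))"
  by (induction S rule: infinite_finite_induct) (simp_all add: f_mult f_one)

lemma f_of_sign: "f (of_int (sign p)) = of_int (sign p)"
  by (simp add: sign_def f_one minus)

lemma map_matrix_mult: "map_matrix f (A ** B) = map_matrix f A ** map_matrix f B"
  by (simp add: vec_eq_iff matrix_matrix_mult_def sum f_mult)

lemma det_map_matrix: "det (map_matrix f A) = f (det A)"
  by (simp add: det_def sum f_mult f_prod f_of_sign)

end

lemma field_embedding_ring_hom:
  assumes "f \<in> ring_hom ring_of_type_algebra ring_of_type_algebra"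
  shows "field_embedding f"
  using assms by unfold_locales (auto simp: ring_hom_def ring_of_type_algebra_def)

text \<open>This form exposes the twist as a scaling of each of the rows by \<open>\<rho> g\<close>.\<close>

lemma twist_eq: "twist i \<sigma> \<rho> g = (\<chi> a. \<rho> g *s (map_matrix i (\<sigma> g) $ a))"
  by (simp add: twist_def vec_eq_iff)

lemma det_twist:
  assumes "field_embedding i"
  shows "det (twist i \<sigma> \<rho> g :: 'a::field ^ 'r ^ 'r) = \<rho> g ^ CARD('r) * i (det (\<sigma> g))"
  unfolding twist_eq
  by (subst det_rows_mul) (simp add: field_embedding.det_map_matrix[OF assms])

lemma twist_mult:
  assumes "field_embedding i"
    and "\<sigma> (x \<otimes>\<^bsub>G\<^esub> y) = \<sigma> x ** \<sigma> y" "\<rho> (x \<otimes>\<^bsub>G\<^esub> y) = \<rho> x * \<rho> y"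
  shows "twist i \<sigma> \<rho> (x \<otimes>\<^bsub>G\<^esub> y) = twist i \<sigma> \<rho> x ** twist i \<sigma> \<rho> y"
proof -
  interpret field_embedding i
    by fact
  show ?thesis
    by (simp add: vec_eq_iff twist_def assms matrix_matrix_mult_def sum f_mult sum_distrib_left ac_simps)
qed

lemma hom_mult_group_nonzero:
  "\<rho> \<in> hom G mult_group \<Longrightarrow> g \<in> carrier G \<Longrightarrow> \<rho> g \<noteq> 0"
  by (auto simp: hom_def mult_group_def units_of_def Units_def ring_of_type_algebra_def Pi_def)

lemma hom_mult_group_mult:
  "\<rho> \<in> hom G mult_group \<Longrightarrow> g \<in> carrier G \<Longrightarrow> h \<in> carrier G \<Longrightarrow>
    \<rho> (g \<otimes>\<^bsub>G\<^esub> h) = \<rho> g * \<rho> h"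
  by (simp add: hom_def mult_group_def units_of_def ring_of_type_algebra_def)

lemma hom_mult_group_one:
  assumes "group G" "\<rho> \<in> hom G mult_group"
  shows "\<rho> \<one>\<^bsub>G\<^esub> = 1"
proof -
  interpret group G by fact
  show ?thesis
    using hom_mult_group_mult[OF assms(2), of "\<one>\<^bsub>G\<^esub>" "\<one>\<^bsub>G\<^esub>"]
      hom_mult_group_nonzero[OF assms(2), of "\<one>\<^bsub>G\<^esub>"] by simp
qed

lemma hom_GL_mult:
  "\<sigma> \<in> hom G GL \<Longrightarrow> g \<in> carrier G \<Longrightarrow> h \<in> carrier G \<Longrightarrow>
    \<sigma> (g \<otimes>\<^bsub>G\<^esub> h) = \<sigma> g ** \<sigma> h"
  by (simp add: hom_def GL_def)

lemma hom_GL_one: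
  assumes "group G" "\<sigma> \<in> hom G GL"
  shows "\<sigma> \<one>\<^bsub>G\<^esub> = mat 1"
proof -
  interpret group G by fact
  let ?A = "\<sigma> \<one>\<^bsub>G\<^esub>"
  have "invertible ?A"
    using assms(2) by (auto simp: hom_def GL_def)
  then obtain B where B: "B ** ?A = mat 1"
    unfolding invertible_def by blast
  have "?A = B ** (?A ** ?A)"
    by (simp add: matrix_mul_assoc B)
  also have "?A ** ?A = ?A"
    using hom_GL_mult[OF assms(2), of "\<one>\<^bsub>G\<^esub>" "\<one>\<^bsub>G\<^esub>"] by simp
  finally show ?thesis
    by (simp add: B)
qed

theorem lemma5p1:
  fixes G :: "('g, 'b) monoid_scheme"
    and vk :: "'k::field \<Rightarrow> ereal"
    and v :: "'a::alg_closed_field \<Rightarrow> ereal"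
    and vh :: "'h::{field, complete_space} \<Rightarrow> ereal"
    and i :: "'k \<Rightarrow> 'a" and j :: "'a \<Rightarrow> 'h"
    and \<sigma> :: "'g \<Rightarrow> 'k ^ 'r ^ 'r"
    and \<rho> :: "'g \<Rightarrow> 'a"
  assumes "finitely_generated_group G"
    and "valued_extension vk v i"
    and "nontrivial_valuation v"
    and "is_completion v vh j"
    and "\<sigma> \<in> hom G GL"
    and "\<rho> \<in> hom G mult_group"
    and bounded: "\<exists>d::real. \<forall>g\<in>carrier G. \<forall>a b. ereal d \<le> vk (\<sigma> g $ a $ b)"
    and det_unit: "\<And>g. g \<in> carrier G \<Longrightarrow> vk (det (\<sigma> g)) = 0"
  shows "(\<forall>g\<in>carrier G. twist_char v i \<sigma> \<rho> g = real CARD('r) * real_of_ereal (v (\<rho> g))) \<and>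
         (\<forall>n\<in>carrier (novikov G (\<lambda>g. - twist_char v i \<sigma> \<rho> g)). \<forall>x.
            twist_term j i \<sigma> \<rho> n x summable_on carrier G) \<and>
         left_module (novikov G (\<lambda>g. - twist_char v i \<sigma> \<rho> g))
           (vec_module (\<lambda>n x. infsum (twist_term j i \<sigma> \<rho> n x) (carrier G)))"
proof -
  interpret group G
    using assms(1) by (simp add: finitely_generated_group_def)
  note \<rho> = hom_mult_group_mult[OF assms(6)] hom_mult_group_nonzero[OF assms(6)]
    hom_mult_group_one[OF is_group assms(6)]
  note \<sigma> = hom_GL_mult[OF assms(5)] hom_GL_one[OF is_group assms(5)]
  interpret K: valuation v
    using assms(2) by unfold_locales (simp add: valued_extension_def)
  interpret Kh: valuation vh
    using assms(4) by unfold_locales (simp add: is_completion_def valued_extension_def)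
  interpret i: field_embedding i
    using assms(2) by (intro field_embedding_ring_hom) (simp add: valued_extension_def)
  interpret j: field_embedding j
    using assms(4) by (intro field_embedding_ring_hom) (simp add: is_completion_def valued_extension_def)
  have vi: "v (i x) = vk x" for x
    using assms(2) by (simp add: valued_extension_def)
  have vj: "vh (j x) = v x" for x
    using assms(4) by (simp add: is_completion_def valued_extension_def)

  have char: "twist_char v i \<sigma> \<rho> g = real CARD('r) * real_of_ereal (v (\<rho> g))"
    if g: "g \<in> carrier G" for g
  proof -
    \<comment> \<open>Otherwise the value of \<open>det (\<sigma> g)\<close> would be \<open>\<infinity>\<close>.\<close>
    have "i (det (\<sigma> g)) \<noteq> 0"
      using det_unit[OF g] vi[of "det (\<sigma> g)"] by force
    then show ?thesis
      using det_unit[OF g] \<rho>(2)[OF g]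
      by (simp add: twist_char_def det_twist[OF i.field_embedding_axioms] K.real_v_mult
          K.real_v_power vi)
  qed

  obtain d :: real where d: "\<And>g a b. g \<in> carrier G \<Longrightarrow> ereal d \<le> vk (\<sigma> g $ a $ b)"
    using bounded by blast

  \<comment> \<open>The rate \<open>1 / r\<close> comes from \<open>\<chi> = r (\<upsilon> \<circ> \<rho>)\<close>, the constant \<open>exp (- d)\<close> from the entries of \<open>\<sigma>\<close>.\<close>
  interpret bounded_representation G "\<lambda>g. - twist_char v i \<sigma> \<rho> g" "val_abs vh"
    "\<lambda>g. map_matrix j (twist i \<sigma> \<rho> g)" "exp (- d)" "1 / real CARD('r)"
  proof unfold_locales
    fix g h
    assume gh: "g \<in> carrier G" "h \<in> carrier G"
    then show "- twist_char v i \<sigma> \<rho> (g \<otimes>\<^bsub>G\<^esub> h) =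
        - twist_char v i \<sigma> \<rho> g + - twist_char v i \<sigma> \<rho> h"
      by (simp add: char \<rho> K.real_v_mult algebra_simps)
    show "map_matrix j (twist i \<sigma> \<rho> (g \<otimes>\<^bsub>G\<^esub> h)) =
        map_matrix j (twist i \<sigma> \<rho> g) ** map_matrix j (twist i \<sigma> \<rho> h)"
      by (simp add: j.map_matrix_mult twist_mult[OF i.field_embedding_axioms] \<sigma> \<rho> gh)
  next
    show "map_matrix j (twist i \<sigma> \<rho> \<one>\<^bsub>G\<^esub>) = mat 1"
      by (simp add: vec_eq_iff twist_def \<sigma> \<rho> mat_def i.f_one i.zero j.f_one j.zero)
  next
    fix x y
    show "val_abs vh (x * y) = val_abs vh x * val_abs vh y"
      by (rule Kh.val_abs_mult)
    show "val_abs vh (x + y) \<le> max (val_abs vh x) (val_abs vh y)"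
      by (rule Kh.val_abs_add)
    show "dist x y = val_abs vh (x - y)"
      using assms(4) by (simp add: is_completion_def)
  next
    fix g a b
    assume g: "g \<in> carrier G"
    let ?s = "\<sigma> g $ a $ b"
    have "val_abs vh (j (\<rho> g)) = exp (- real_of_ereal (v (\<rho> g)))"
      using \<rho>(2)[OF g] vj[of "\<rho> g"] K.v_finite[of "\<rho> g"] by (auto simp: val_abs_def)
    moreover have "val_abs vh (j (i ?s)) \<le> exp (- d)"
      by (rule Kh.val_abs_le_exp) (simp add: vi vj d g)
    ultimately show "val_abs vh (map_matrix j (twist i \<sigma> \<rho> g) $ a $ b)
        \<le> exp (- d) * exp (1 / real CARD('r) * - twist_char v i \<sigma> \<rho> g)"
      by (simp add: twist_def j.f_mult Kh.val_abs_mult char g)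
  qed simp

  have "twist_term j i \<sigma> \<rho> = series_term"
    by (intro ext) (simp add: twist_term_def series_term_def)
  moreover have "(\<lambda>n x. infsum (series_term n x) (carrier G)) = act"
    by (intro ext) (simp add: act_def)
  ultimately show ?thesis
    using char left_module_act has_sum_act unfolding summable_on_def by auto
qed

end
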